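(* There exist a rational polyhedron $\mathcal{P} \subseteq \mathbb{R}^2$ and a quadratic polynomial $f \colon \mathbb{R}^2 \to \mathbb{R}$ (with real coefficients) such that $f$ is unbounded below on $\mathcal{P} \cap \mathbb{Z}^2$, and for every ray $\mathcal{R}(y,d)$ of $\mathcal{P}$, $f$ is bounded below on $\mathcal{R}(y,d) \cap \mathbb{Z}^2$.
   Context: A polyhedron is a set $\mathcal{P} = \{x \in \mathbb{R}^n : Ax \le b\}$ with $A \in \mathbb{R}^{m \times n}$, $b \in \mathbb{R}^m$; it is rational if $A \in \mathbb{Q}^{m\times n}$ and $b \in \mathbb{Q}^m$. A ray in $\mathbb{R}^n$ is a set $\mathcal{R}(y,d) = \{y + \lambda d : \lambda \ge 0\}$ with $y \in \mathbb{R}^n$ and nonzero $d \in \mathbb{R}^n$. A ray of $\mathcal{P}$ is a ray fully contained in $\mathcal{P}$. A quadratic polynomial is a polynomial of degree two. A function $f$ is unbounded below on a set $S$ if for every $c \in \mathbb{R}$ there is $x \in S$ with $f(x) < c$, and bounded below on $S$ otherwise (in particular, bounded below on the empty set). *)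

theory Defs
  imports "HOL-Analysis.Analysis"
begin

definition rational_polyhedron :: "(real ^ 'n) set \<Rightarrow> bool" where
  "rational_polyhedron P \<longleftrightarrow>
     (\<exists>(m::nat) (A :: nat \<Rightarrow> real ^ 'n) (b :: nat \<Rightarrow> real).
        (\<forall>i<m. (\<forall>j. A i $ j \<in> \<rat>) \<and> b i \<in> \<rat>) \<and>
        P = {x. \<forall>i<m. A i \<bullet> x \<le> b i})"

text \<open>
  The function \<open>f\<close> is given by a real polynomial of total degree exactly \<open>k\<close>. A monomial is
  represented by its exponent vector \<open>\<alpha>\<close>, and \<open>c \<alpha>\<close> is its coefficient.
\<close>

definition polynomial_of_degree :: "nat \<Rightarrow> (real ^ 'n \<Rightarrow> real) \<Rightarrow> bool" where
  "polynomial_of_degree k f \<longleftrightarrow>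
     (\<exists>c :: ('n \<Rightarrow> nat) \<Rightarrow> real.
        (\<forall>x. f x = (\<Sum>\<alpha> | (\<Sum>i\<in>UNIV. \<alpha> i) \<le> k. c \<alpha> * (\<Prod>i\<in>UNIV. (x $ i) ^ \<alpha> i))) \<and>
        (\<exists>\<alpha>. (\<Sum>i\<in>UNIV. \<alpha> i) = k \<and> c \<alpha> \<noteq> 0))"

text \<open>The index set of the sum above is finite, so the sum is not degenerate.\<close>

lemma finite_exponents: "finite {\<alpha> :: 'n::finite \<Rightarrow> nat. (\<Sum>i\<in>UNIV. \<alpha> i) \<le> k}"
proof (rule finite_subset)
  show "{\<alpha> :: 'n \<Rightarrow> nat. (\<Sum>i\<in>UNIV. \<alpha> i) \<le> k} \<subseteq> (UNIV \<rightarrow>\<^sub>E {..k})"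
  proof
    fix \<alpha> :: "'n \<Rightarrow> nat"
    assume "\<alpha> \<in> {\<alpha>. (\<Sum>i\<in>UNIV. \<alpha> i) \<le> k}"
    moreover have "\<alpha> i \<le> (\<Sum>i\<in>UNIV. \<alpha> i)" for i
      by (rule member_le_sum) auto
    ultimately show "\<alpha> \<in> (UNIV \<rightarrow>\<^sub>E {..k})"
      by (auto intro: order_trans)
  qed
qed (intro finite_PiE; simp)

abbreviation quadratic_polynomial :: "(real ^ 'n \<Rightarrow> real) \<Rightarrow> bool" where
  "quadratic_polynomial \<equiv> polynomial_of_degree 2"

definition integer_points :: "(real ^ 'n) set" where
  "integer_points = {x. \<forall>i. x $ i \<in> \<int>}"

text \<open>This is a ray only if \<open>d \<noteq> 0\<close>, which has to be required wherever it is used.\<close>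

definition ray :: "real ^ 'n \<Rightarrow> real ^ 'n \<Rightarrow> (real ^ 'n) set" where
  "ray y d = {y + t *\<^sub>R d | t. t \<ge> 0}"

end

theory Submission
  imports Defs
begin

text \<open>
  Take \<open>P = UNIV\<close> and \<open>f (x, y) = (x - \<alpha> y)\<^sup>2 - y\<close> for an irrational \<open>\<alpha>\<close>. The quadratic part is
  positive semidefinite and vanishes only in the direction \<open>(\<alpha>, 1)\<close> and its multiples. Along any
  other direction \<open>f\<close> is a convex parabola, hence bounded below
  (\<open>bdd_below_ray_transversal\<close>). Along the exceptional direction \<open>f\<close> may decrease without
  bound, but such a ray carries at most one integer point, because \<open>\<alpha>\<close> is irrational
  (\<open>integer_points_on_irrational_line\<close>). On the other hand, the integer points just left of the line
  \<open>x = \<alpha> y\<close> stay within horizontal distance 1 of it while \<open>y\<close> grows, so the linear term drives \<open>f\<close> to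
  \<open>- \<infinity>\<close> along them (\<open>tilted_square_unbounded\<close>). They approximate the exceptional direction
  without ever settling on a ray.
\<close>

definition tilted_square :: "real \<Rightarrow> real ^ 2 \<Rightarrow> real" where
  "tilted_square \<alpha> x = (x $ 1 - \<alpha> * x $ 2)\<^sup>2 - x $ 2"

lemma exists_irrational: "\<exists>\<alpha>::real. \<alpha> \<notin> \<rat>"
  using uncountable_UNIV_real countable_rat by (metis UNIV_eq_I)

lemma rational_polyhedron_UNIV: "rational_polyhedron UNIV"
  unfolding rational_polyhedron_def by (rule exI[of _ 0]) simp

text \<open>
  Exponent vectors over two variables are traded for pairs, so that the sum over all monomials of
  degree at most two becomes an explicit sum of six terms.
\<close>

lemma sum_exponents_2:
  fixes g :: "nat \<Rightarrow> nat \<Rightarrow> real"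
  shows "(\<Sum>e::2 \<Rightarrow> nat | (\<Sum>i\<in>UNIV. e i) \<le> 2. g (e 1) (e 2)) =
    g 0 0 + g 1 0 + g 0 1 + g 2 0 + g 1 1 + g 0 2"
proof -
  let ?S = "{(0,0), (1,0), (0,1), (2,0), (1,1), (0,2)} :: (nat \<times> nat) set"
  have S: "(a, b) \<in> ?S \<longleftrightarrow> a + b \<le> 2" for a b by auto
  have "(\<Sum>e::2 \<Rightarrow> nat | (\<Sum>i\<in>UNIV. e i) \<le> 2. g (e 1) (e 2)) = (\<Sum>(a, b)\<in>?S. g a b)"
  proof (rule sum.reindex_bij_witness
      [where i = "\<lambda>(a, b) i. if i = 1 then a else b" and j = "\<lambda>e. (e 1, e 2)"])
    fix e :: "2 \<Rightarrow> nat"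
    show "(case (e 1, e 2) of (a, b) \<Rightarrow> \<lambda>i. if i = 1 then a else b) = e"
      using exhaust_2 by fastforce
    assume "e \<in> {e. (\<Sum>i\<in>UNIV. e i) \<le> 2}"
    then show "(e 1, e 2) \<in> ?S" by (simp only: S sum_2 mem_Collect_eq)
  qed (auto simp: sum_2)
  then show ?thesis by simp
qed

lemma quadratic_tilted_square: "quadratic_polynomial (tilted_square \<alpha>)"
proof -
  define c :: "nat \<Rightarrow> nat \<Rightarrow> real" where
    "c a b = (if (a, b) = (2, 0) then 1 else if (a, b) = (1, 1) then - 2 * \<alpha>
       else if (a, b) = (0, 2) then \<alpha>\<^sup>2 else if (a, b) = (0, 1) then - 1 else 0)" for a b
  have "tilted_square \<alpha> x = (\<Sum>e::2 \<Rightarrow> nat | (\<Sum>i\<in>UNIV. e i) \<le> 2.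
      c (e 1) (e 2) * (\<Prod>i\<in>UNIV. (x $ i) ^ e i))" for x
    using sum_exponents_2[of "\<lambda>a b. c a b * ((x $ 1) ^ a * (x $ 2) ^ b)"]
    by (simp add: UNIV_2 c_def tilted_square_def power2_eq_square algebra_simps)
  moreover have "(\<Sum>i\<in>UNIV. (if i = (1::2) then 2 else 0)) = (2::nat)"
    "c (if (1::2) = 1 then 2 else 0) (if (2::2) = 1 then 2 else 0) \<noteq> 0"
    by (simp_all add: c_def)
  ultimately show ?thesis
    unfolding polynomial_of_degree_def by (intro exI[of _ "\<lambda>e. c (e 1) (e 2)"]) blast
qed

lemma tilted_square_unbounded: "\<not> bdd_below (tilted_square \<alpha> ` integer_points)"
proof
  assume "bdd_below (tilted_square \<alpha> ` integer_points)"
  then obtain m where m: "m \<le> tilted_square \<alpha> x" if "x \<in> integer_points" for x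
    unfolding bdd_below_def by blast
  obtain n :: nat where n: "1 - m < real n" using reals_Archimedean2 by blast
  \<comment> \<open>The integer point at height \<open>n\<close> on or just left of the line where the square vanishes.\<close>
  let ?r = "of_int \<lfloor>\<alpha> * real n\<rfloor> :: real"
  have "vector [?r, real n] \<in> (integer_points :: (real ^ 2) set)"
    by (simp add: integer_points_def forall_2)
  then have "m \<le> (?r - \<alpha> * real n)\<^sup>2 - real n"
    using m by (fastforce simp: tilted_square_def)
  moreover have "(?r - \<alpha> * real n)\<^sup>2 \<le> 1"
    unfolding abs_square_le_1 by linarith
  ultimately show False using n by linarith
qed

text \<open>
  The level lines of \<open>x - \<alpha> y\<close> have irrational slope, whereas two distinct integer points span a
  line whose slope is rational or infinite.
\<close>

lemma integer_points_on_irrational_line: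
  fixes p q :: "real ^ 2"
  assumes "\<alpha> \<notin> \<rat>" "p \<in> integer_points" "q \<in> integer_points"
    and eq: "p $ 1 - \<alpha> * p $ 2 = q $ 1 - \<alpha> * q $ 2"
  shows "p = q"
proof -
  have Q: "p $ i - q $ i \<in> \<rat>" for i
    using assms(2,3) Ints_subset_Rats by (auto simp: integer_points_def)
  have diff: "p $ 1 - q $ 1 = \<alpha> * (p $ 2 - q $ 2)" using eq by (simp add: algebra_simps)
  have "p $ 2 = q $ 2"
  proof (rule ccontr)
    assume "p $ 2 \<noteq> q $ 2"
    then have "\<alpha> = (p $ 1 - q $ 1) / (p $ 2 - q $ 2)" using diff by simp
    with Q \<open>\<alpha> \<notin> \<rat>\<close> show False by (metis Rats_divide)
  qed
  with diff show ?thesis by (simp add: vec_eq_iff forall_2)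
qed

text \<open>
  The argument of the square changes at a nonzero rate along such a ray, so the square grows
  quadratically in the parameter and dominates the linear term.
\<close>

lemma bdd_below_ray_transversal:
  assumes "d $ 1 - \<alpha> * d $ 2 \<noteq> 0"
  shows "bdd_below (tilted_square \<alpha> ` ray y d)"
proof (rule bdd_belowI2)
  have complete_square: "u\<^sup>2 - k * (u - a) - c = (u - k / 2)\<^sup>2 + (k * a - k\<^sup>2 / 4 - c)"
    for u k a c :: real
    by (simp add: power2_eq_square field_simps)
  let ?a = "y $ 1 - \<alpha> * y $ 2" and ?b = "d $ 1 - \<alpha> * d $ 2"
  \<comment> \<open>In the parameter \<open>u = ?a + t * ?b\<close>, \<open>f\<close> is \<open>u\<^sup>2 - k * u\<close> plus a constant.\<close>
  let ?k = "d $ 2 / ?b"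
  fix x assume "x \<in> ray y d"
  then obtain t where x: "x = y + t *\<^sub>R d" by (auto simp: ray_def)
  let ?u = "?a + t * ?b"
  have "t * d $ 2 = ?k * (?u - ?a)" using assms by simp
  moreover have "x $ 1 - \<alpha> * x $ 2 = ?u" "x $ 2 = y $ 2 + t * d $ 2"
    by (simp_all add: x algebra_simps)
  ultimately have "tilted_square \<alpha> x = ?u\<^sup>2 - ?k * (?u - ?a) - y $ 2"
    by (simp only: tilted_square_def)
  also have "\<dots> = (?u - ?k / 2)\<^sup>2 + (?k * ?a - ?k\<^sup>2 / 4 - y $ 2)"
    by (rule complete_square)
  finally show "?k * ?a - ?k\<^sup>2 / 4 - y $ 2 \<le> tilted_square \<alpha> x" by simp
qed

lemma bdd_below_ray_integer_points:
  assumes "\<alpha> \<notin> \<rat>"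
  shows "bdd_below (tilted_square \<alpha> ` (ray y d \<inter> integer_points))"
proof (cases "d $ 1 - \<alpha> * d $ 2 = 0")
  case True
  have "p $ 1 - \<alpha> * p $ 2 = y $ 1 - \<alpha> * y $ 2" if "p \<in> ray y d" for p
  proof -
    from that obtain t where "p = y + t *\<^sub>R d" by (auto simp: ray_def)
    then have "p $ 1 - \<alpha> * p $ 2 = y $ 1 - \<alpha> * y $ 2 + t * (d $ 1 - \<alpha> * d $ 2)"
      by (simp add: algebra_simps)
    with True show ?thesis by simp
  qed
  then have eq: "p = q" if "p \<in> ray y d \<inter> integer_points" "q \<in> ray y d \<inter> integer_points" for p q
    using that integer_points_on_irrational_line[OF assms] by (metis IntE)
  have "finite (ray y d \<inter> integer_points)"
    using eq by (metis finite.emptyI finite_insert finite_subset singletonI subsetI equals0I)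
  then show ?thesis by simp
next
  case False
  from bdd_below_ray_transversal[OF this] show ?thesis
    by (rule bdd_below_mono) auto
qed

theorem proposition2:
  "\<exists>(P :: (real ^ 2) set) (f :: real ^ 2 \<Rightarrow> real).
     rational_polyhedron P \<and> quadratic_polynomial f \<and>
     \<not> bdd_below (f ` (P \<inter> integer_points)) \<and>
     (\<forall>y d. d \<noteq> 0 \<longrightarrow> ray y d \<subseteq> P \<longrightarrow> bdd_below (f ` (ray y d \<inter> integer_points)))"
proof -
  obtain \<alpha> :: real where "\<alpha> \<notin> \<rat>" using exists_irrational by blast
  then show ?thesis
    using rational_polyhedron_UNIV quadratic_tilted_square[of \<alpha>] tilted_square_unbounded[of \<alpha>]
      bdd_below_ray_integer_points[of \<alpha>]
    by (intro exI[of _ UNIV] exI[of _ "tilted_square \<alpha>"]) simp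
qed

end
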